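(* Let $\mathfrak g$ be a finite-dimensional real Lie algebra with an ad-invariant metric $g$. Then $\mathfrak g$ is solitary if and only if the complexified metric $g^{\mathbb C}$ (the $\mathbb C$-bilinear extension of $g$) is solitary on the complexification $\mathfrak g^{\mathbb C}=\mathfrak g\otimes\mathbb C$.
   Context: Let $\mathbb K=\mathbb R$ or $\mathbb C$. A metric on a Lie algebra over $\mathbb K$ is a nondegenerate symmetric $\mathbb K$-bilinear form $g$; it is ad-invariant if $g([X,Y],Z)=-g(Y,[X,Z])$ for all $X,Y,Z$. A $\mathbb K$-linear endomorphism $\phi$ is ad-invariant if $\phi([X,Y])=[X,\phi(Y)]$ for all $X,Y$. For a linear map $f$, $f^{*_g}$ denotes its adjoint with respect to $g$. An ad-invariant metric $g$ is solitary if every ad-invariant $g$-self-adjoint $\mathbb K$-linear endomorphism $\phi$ of the Lie algebra can be written as $\phi=D+D^{*_g}$ for some ($\mathbb K$-linear) derivation $D$. A Lie algebra is solitary if it admits an ad-invariant metric and one (equivalently, every) ad-invariant metric on it is solitary. *)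

theory Defs
  imports Complex_Main "HOL-Library.Product_Plus"
begin

locale lie_algebra = vector_space scale
  for scale :: "'k::field \<Rightarrow> 'v::ab_group_add \<Rightarrow> 'v" +
  fixes bracket :: "'v \<Rightarrow> 'v \<Rightarrow> 'v"
  assumes linear_bracket_right: "Vector_Spaces.linear scale scale (\<lambda>y. bracket x y)"
    and linear_bracket_left: "Vector_Spaces.linear scale scale (\<lambda>x. bracket x y)"
    and bracket_self: "bracket x x = 0"
    and jacobi: "bracket x (bracket y z) + bracket y (bracket z x) + bracket z (bracket x y) = 0"

locale finite_dimensional_lie_algebra = lie_algebra +
  assumes finite_dimensional: "\<exists>B. finite B \<and> span B = UNIV"

text \<open>The adjoint of \<open>f\<close> with respect to a bilinear form \<open>g\<close>. For nondegenerate \<open>g\<close> there is at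
  most one such map, it is linear if \<open>f\<close> is, and in finite dimension it exists for every linear
  \<open>f\<close>.\<close>

definition form_adjoint :: "('v \<Rightarrow> 'v \<Rightarrow> 'k) \<Rightarrow> ('v \<Rightarrow> 'v) \<Rightarrow> 'v \<Rightarrow> 'v" where
  "form_adjoint g f = (THE h. \<forall>x y. g (f x) y = g x (h y))"

context lie_algebra
begin

definition metric :: "('v \<Rightarrow> 'v \<Rightarrow> 'k) \<Rightarrow> bool" where
  "metric g \<longleftrightarrow>
     (\<forall>x. Vector_Spaces.linear scale (*) (\<lambda>y. g x y)) \<and>
     (\<forall>y. Vector_Spaces.linear scale (*) (\<lambda>x. g x y)) \<and>
     (\<forall>x y. g x y = g y x) \<and>
     (\<forall>x. (\<forall>y. g x y = 0) \<longrightarrow> x = 0)"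

definition ad_invariant_metric :: "('v \<Rightarrow> 'v \<Rightarrow> 'k) \<Rightarrow> bool" where
  "ad_invariant_metric g \<longleftrightarrow>
     metric g \<and> (\<forall>x y z. g (bracket x y) z = - g y (bracket x z))"

definition ad_invariant_endo :: "('v \<Rightarrow> 'v) \<Rightarrow> bool" where
  "ad_invariant_endo \<phi> \<longleftrightarrow>
     Vector_Spaces.linear scale scale \<phi> \<and> (\<forall>x y. \<phi> (bracket x y) = bracket x (\<phi> y))"

definition derivation :: "('v \<Rightarrow> 'v) \<Rightarrow> bool" where
  "derivation D \<longleftrightarrow>
     Vector_Spaces.linear scale scale D \<and>
     (\<forall>x y. D (bracket x y) = bracket (D x) y + bracket x (D y))"

definition solitary_metric :: "('v \<Rightarrow> 'v \<Rightarrow> 'k) \<Rightarrow> bool" where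
  "solitary_metric g \<longleftrightarrow>
     ad_invariant_metric g \<and>
     (\<forall>\<phi>. ad_invariant_endo \<phi> \<and> form_adjoint g \<phi> = \<phi> \<longrightarrow>
        (\<exists>D. derivation D \<and> (\<forall>x. \<phi> x = D x + form_adjoint g D x)))"

text \<open>In finite dimension, over the reals or the complex numbers, one ad-invariant metric is
  solitary iff all of them are.\<close>

definition solitary :: bool where
  "solitary \<longleftrightarrow> (\<exists>g. solitary_metric g)"

end

text \<open>The complexification of a real vector space \<open>V\<close> is modelled on \<open>V \<times> V\<close> with componentwise
  addition, the pair \<open>(x, y)\<close> standing for \<open>x \<otimes> 1 + y \<otimes> \<i>\<close>. The bracket and
  the form are the complex-bilinear extensions of the real ones.\<close>

fun complexify_scale :: "(real \<Rightarrow> 'v \<Rightarrow> 'v) \<Rightarrow> complex \<Rightarrow> 'v \<times> 'v \<Rightarrow> 'v::ab_group_add \<times> 'v" where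
  "complexify_scale scale c (x, y) =
     (scale (Re c) x - scale (Im c) y, scale (Re c) y + scale (Im c) x)"

fun complexify_bracket ::
  "('v \<Rightarrow> 'v \<Rightarrow> 'v) \<Rightarrow> 'v \<times> 'v \<Rightarrow> 'v \<times> 'v \<Rightarrow> 'v::ab_group_add \<times> 'v" where
  "complexify_bracket br (x, y) (u, v) = (br x u - br y v, br x v + br y u)"

fun complexify_form :: "('v \<Rightarrow> 'v \<Rightarrow> real) \<Rightarrow> 'v \<times> 'v \<Rightarrow> 'v \<times> 'v \<Rightarrow> complex" where
  "complexify_form g (x, y) (u, v) = Complex (g x u - g y v) (g x v + g y u)"

lemma vector_space_complexify:
  assumes "vector_space scale"
  shows "vector_space (complexify_scale scale)"
proof -
  interpret vector_space scale by fact
  show ?thesis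
    by unfold_locales
      (auto simp: scale_right_distrib scale_left_distrib scale_left_diff_distrib
        scale_right_diff_distrib)
qed

text \<open>The universal property of \<open>V \<otimes>\<^sub>\<real> \<complex>\<close>: real-linear maps from \<open>V\<close> to a
  complex vector space extend uniquely to complex-linear maps.\<close>

lemma complexify_universal:
  fixes f :: "'v::ab_group_add \<Rightarrow> 'w::ab_group_add"
  assumes "vector_space cscale"
    and f: "Vector_Spaces.linear scale (\<lambda>r. cscale (complex_of_real r)) f"
  shows "\<exists>!F. Vector_Spaces.linear (complexify_scale scale) cscale F \<and> (\<forall>x. F (x, 0) = f x)"
proof -
  interpret W: vector_space cscale by fact
  interpret f: Vector_Spaces.linear scale "\<lambda>r. cscale (complex_of_real r)" f by fact
  interpret C: vector_space "complexify_scale scale"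
    by (rule vector_space_complexify) unfold_locales
  define F where "F = (\<lambda>(x, y). f x + cscale \<i> (f y))"
  have "F (complexify_scale scale c p) = cscale c (F p)" for c p
  proof -
    obtain x y where p: "p = (x, y)" by force
    have c: "c * \<i> = - complex_of_real (Im c) + \<i> * complex_of_real (Re c)"
      by (simp add: complex_eq_iff)
    have "cscale c (f x) = cscale (complex_of_real (Re c)) (f x) +
        cscale (\<i> * complex_of_real (Im c)) (f x)"
      by (simp flip: W.scale_left_distrib complex_eq)
    moreover have "cscale (c * \<i>) (f y) = - cscale (complex_of_real (Im c)) (f y) +
        cscale (\<i> * complex_of_real (Re c)) (f y)"
      unfolding c W.scale_left_distrib by simp
    ultimately show ?thesis
      by (simp add: p F_def f.add f.diff f.scale W.scale_right_distrib)
  qed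
  then have "Vector_Spaces.linear (complexify_scale scale) cscale F"
    by unfold_locales (auto simp: F_def f.add W.scale_right_distrib)
  moreover have "F (x, 0) = f x" for x
    by (simp add: F_def f.zero)
  moreover have "G = F"
    if G: "Vector_Spaces.linear (complexify_scale scale) cscale G" and G0: "\<forall>x. G (x, 0) = f x" for G
  proof
    fix p :: "'v \<times> 'v"
    interpret G: Vector_Spaces.linear "complexify_scale scale" cscale G by fact
    obtain x y where p: "p = (x, y)" by force
    have "p = (x, 0) + complexify_scale scale \<i> (y, 0)" by (simp add: p)
    then show "G p = F p" by (simp only: G.add G.scale G0) (simp add: p F_def G0)
  qed
  ultimately show ?thesis by blast
qed

lemma lie_algebra_complexify:
  assumes "lie_algebra scale bracket"
  shows "lie_algebra (complexify_scale scale) (complexify_bracket bracket)"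
proof -
  interpret lie_algebra scale bracket by fact
  interpret C: vector_space "complexify_scale scale"
    by (rule vector_space_complexify) unfold_locales
  interpret R: Vector_Spaces.linear scale scale "\<lambda>y. bracket x y" for x
    by (rule linear_bracket_right)
  interpret L: Vector_Spaces.linear scale scale "\<lambda>x. bracket x y" for y
    by (rule linear_bracket_left)
  have anti: "bracket x y + bracket y x = 0" for x y
  proof -
    have "bracket (x + y) (x + y) = bracket x x + bracket y y + (bracket x y + bracket y x)"
      unfolding R.add L.add by (simp only: ac_simps)
    then show ?thesis by (simp add: bracket_self)
  qed
  show ?thesis
  proof unfold_locales
    fix p q r :: "'a \<times> 'a" and c :: complex
    obtain a a' b b' d d' where [simp]: "p = (a, a')" "q = (b, b')" "r = (d, d')" by force
    show "complexify_bracket bracket p (q + r) =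
        complexify_bracket bracket p q + complexify_bracket bracket p r"
      and "complexify_bracket bracket (p + q) r =
        complexify_bracket bracket p r + complexify_bracket bracket q r"
      by (simp_all add: R.add L.add algebra_simps)
    show "complexify_bracket bracket p (complexify_scale scale c q) =
        complexify_scale scale c (complexify_bracket bracket p q)"
      and "complexify_bracket bracket (complexify_scale scale c p) q =
        complexify_scale scale c (complexify_bracket bracket p q)"
      by (simp_all add: R.add L.add R.diff L.diff R.scale L.scale scale_right_distrib
          scale_right_diff_distrib algebra_simps)
    show "complexify_bracket bracket p p = 0"
      using anti[of a a'] by (simp add: bracket_self zero_prod_def)
    define J where "J x y z =
      bracket x (bracket y z) + bracket y (bracket z x) + bracket z (bracket x y)" for x y z
    have "complexify_bracket bracket p (complexify_bracket bracket q r) +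
        complexify_bracket bracket q (complexify_bracket bracket r p) +
        complexify_bracket bracket r (complexify_bracket bracket p q) =
      (J a b d - J a b' d' - J a' b d' - J a' b' d,
       J a b d' + J a b' d + J a' b d - J a' b' d')"
      by (simp add: J_def R.add R.diff algebra_simps)
    also have "\<dots> = 0"
      by (simp add: J_def jacobi zero_prod_def)
    finally show "complexify_bracket bracket p (complexify_bracket bracket q r) +
        complexify_bracket bracket q (complexify_bracket bracket r p) +
        complexify_bracket bracket r (complexify_bracket bracket p q) = 0" .
  qed
qed

end

theory Submission
  imports Defs
begin

text \<open>Polarised, \<open>\<phi> = D + D\<^sup>*\<close> reads \<open>g (\<phi> x) y = g (D x) y + g x (D y)\<close>, which involves no
  adjoints and passes to real and imaginary parts. This gives the claim for a fixed metric. A real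
  Lie algebra is solitary if some metric is, so one also needs independence of the metric: any two
  ad-invariant metrics satisfy \<open>g x y = g' (\<psi> x) y\<close> with \<open>\<psi>\<close> ad-invariant, and derivations form a
  module over the ad-invariant endomorphisms.\<close>

section \<open>Brackets, metrics, ad-invariant maps and derivations over an arbitrary field\<close>

context lie_algebra
begin

lemma bracket_simps:
  "bracket 0 z = 0" "bracket z 0 = 0"
  "bracket (x + y) z = bracket x z + bracket y z" "bracket z (x + y) = bracket z x + bracket z y"
  "bracket (x - y) z = bracket x z - bracket y z" "bracket z (x - y) = bracket z x - bracket z y"
proof -
  interpret l: Vector_Spaces.linear scale scale "\<lambda>x. bracket x y" for y
    by (rule linear_bracket_left)
  interpret r: Vector_Spaces.linear scale scale "\<lambda>y. bracket x y" for x
    by (rule linear_bracket_right)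
  show "bracket 0 z = 0" "bracket z 0 = 0"
    "bracket (x + y) z = bracket x z + bracket y z" "bracket z (x + y) = bracket z x + bracket z y"
    "bracket (x - y) z = bracket x z - bracket y z" "bracket z (x - y) = bracket z x - bracket z y"
    by (fact l.zero r.zero l.add r.add l.diff r.diff)+
qed

lemma bracket_anticommute: "bracket x y = - bracket y x"
proof -
  have "bracket (x + y) (x + y) = bracket x y + bracket y x"
    unfolding bracket_simps by (simp add: bracket_self)
  then show ?thesis by (simp add: bracket_self eq_neg_iff_add_eq_0)
qed

lemma metric_commute: "metric g \<Longrightarrow> g x y = g y x"
  by (simp add: metric_def)

lemma metric_simps:
  assumes "metric g"
  shows "g 0 z = 0" "g z 0 = 0" "g (x + y) z = g x z + g y z" "g z (x + y) = g z x + g z y"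
    "g (x - y) z = g x z - g y z" "g z (x - y) = g z x - g z y"
    "g (scale c x) z = c * g x z" "g z (scale c x) = c * g z x"
proof -
  interpret l: Vector_Spaces.linear scale "(*)" "\<lambda>x. g x y" for y
    using assms by (simp add: metric_def)
  interpret r: Vector_Spaces.linear scale "(*)" "g x" for x
    using assms by (simp add: metric_def)
  show "g 0 z = 0" "g z 0 = 0" "g (x + y) z = g x z + g y z" "g z (x + y) = g z x + g z y"
    "g (x - y) z = g x z - g y z" "g z (x - y) = g z x - g z y"
    "g (scale c x) z = c * g x z" "g z (scale c x) = c * g z x"
    by (fact l.zero r.zero l.add r.add l.diff r.diff l.scale r.scale)+
qed

lemma metric_eqI:
  assumes "metric g" and "\<And>z. g x z = g y z"
  shows "x = y"
proof -
  have "g (x - y) z = 0" for z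
    using assms(2) by (simp add: metric_simps[OF assms(1)])
  then have "x - y = 0" using assms(1) unfolding metric_def by blast
  then show ?thesis by simp
qed

text \<open>\<open>h\<close> is linear in its first argument, and nondegeneracy of \<open>g\<close>
  cancels \<open>y\<close>, so linearity passes to \<open>f\<close>. This serves for the map that
  compares two metrics.\<close>

lemma linearI_metric:
  assumes "metric g" and "metric h" and h: "\<And>x y. h x y = g (f x) y"
  shows "Vector_Spaces.linear scale scale f"
proof -
  have "f (x + y) = f x + f y" and "f (scale c x) = scale c (f x)" for c x y
    by (rule metric_eqI[OF assms(1)],
      simp add: metric_simps[OF assms(1)] metric_simps[OF assms(2)] flip: h)+
  then show ?thesis by (simp add: Vector_Spaces.linear_iff vector_space_axioms)
qed

text \<open>Nondegeneracy leaves at most one candidate, so exhibiting a single \<open>h\<close>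
  settles the definite description in \<open>form_adjoint\<close>.\<close>

lemma form_adjoint_eqI:
  assumes "metric g" and "\<And>x y. g (f x) y = g x (h y)"
  shows "form_adjoint g f = h"
  unfolding form_adjoint_def
proof (rule the_equality)
  fix k assume k: "\<forall>x y. g (f x) y = g x (k y)"
  show "k = h"
  proof
    fix y
    have "g (k y) x = g (h y) x" for x
      using k assms by (metis metric_commute)
    then show "k y = h y" using assms(1) by (rule metric_eqI[rotated])
  qed
qed (use assms in blast)

text \<open>Ad-invariance is defined through the right argument; antisymmetry of the bracket carries
  it to the left one.\<close>

lemma ad_invariant_endo_bracket_left:
  assumes "ad_invariant_endo \<phi>"
  shows "\<phi> (bracket x y) = bracket (\<phi> x) y"
proof -
  interpret \<phi>: Vector_Spaces.linear scale scale \<phi>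
    using assms by (simp add: ad_invariant_endo_def)
  have "\<phi> (bracket x y) = - \<phi> (bracket y x)"
    by (subst bracket_anticommute) (rule \<phi>.neg)
  also have "\<dots> = bracket (\<phi> x) y"
    using assms by (simp add: ad_invariant_endo_def bracket_anticommute[of "\<phi> x"])
  finally show ?thesis .
qed

lemma ad_invariant_endo_comp:
  assumes "ad_invariant_endo \<phi>" and "ad_invariant_endo \<psi>"
  shows "ad_invariant_endo (\<phi> \<circ> \<psi>)"
  using assms by (simp add: ad_invariant_endo_def Vector_Spaces.linear_iff)

text \<open>Apply \<open>\<phi>\<close> to the Leibniz rule for \<open>D\<close>: it moves into the
  left argument of \<open>bracket (D x) y\<close> and into the right argument of
  \<open>bracket x (D y)\<close>.\<close>

lemma derivation_comp:
  assumes "ad_invariant_endo \<phi>" and "derivation D"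
  shows "derivation (\<phi> \<circ> D)"
  using assms ad_invariant_endo_bracket_left[OF assms(1)]
  by (simp add: ad_invariant_endo_def derivation_def Vector_Spaces.linear_iff)

end

section \<open>Existence of adjoints and independence of the metric in finite dimension\<close>

context finite_dimensional_lie_algebra
begin

text \<open>Nondegeneracy makes \<open>x \<mapsto> g x\<close> an injection into the dual space; in
  finite dimension it is therefore onto.\<close>

lemma linear_functional_representation:
  assumes g: "metric g" and f: "Vector_Spaces.linear scale (*) f"
  shows "\<exists>x. \<forall>y. f y = g x y"
proof -
  obtain S where S: "finite S" "span S = UNIV" using finite_dimensional by blast
  obtain B where B: "B \<subseteq> S" "independent B" "S \<subseteq> span B"
    using maximal_independent_subset by blast
  have fin: "finite B" using B(1) S(1) finite_subset by blast
  have span: "span B = UNIV" using B(3) S(2) span_mono span_span by blast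
  interpret fd: finite_dimensional_vector_space scale B
    by unfold_locales (use fin span B(2) in auto)
  interpret f: Vector_Spaces.linear scale "(*)" f by fact
  \<comment> \<open>A functional is encoded as the vector whose coordinates in \<open>B\<close> are
    its values on \<open>B\<close>. This turns \<open>x \<mapsto> g x\<close> into an endomorphism,
    for which injective implies surjective.\<close>
  let ?c = "\<lambda>h. \<Sum>b\<in>B. scale (h b) b"
  have c_inj: "h b = k b" if "?c h = ?c k" "b \<in> B" for h k b
  proof -
    have "(\<Sum>b\<in>B. scale (h b - k b) b) = 0"
      using that(1) by (simp add: scale_left_diff_distrib sum_subtractf)
    then show ?thesis using independentD[OF B(2) fin order_refl _ that(2)] by fastforce
  qed
  have lin_g: "Vector_Spaces.linear scale (*) (g x)" for x
    using g by (simp add: metric_def)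
  have eq: "h y = k y"
    if hk: "\<And>b. b \<in> B \<Longrightarrow> h b = k b" "Vector_Spaces.linear scale (*) h" "Vector_Spaces.linear scale (*) k"
    for h k y
  proof -
    interpret vector_space_pair scale "(*)" by unfold_locales (simp_all add: algebra_simps)
    show ?thesis using linear_eq_on[OF hk(2,3), of y B] hk(1) span by simp
  qed
  have "Vector_Spaces.linear scale scale (\<lambda>x. ?c (g x))"
    by (simp add: Vector_Spaces.linear_iff vector_space_axioms metric_simps[OF g]
      scale_left_distrib sum.distrib scale_sum_right)
  moreover have "inj (\<lambda>x. ?c (g x))"
  proof (rule injI)
    fix x y assume *: "?c (g x) = ?c (g y)"
    have "g x z = g y z" for z
      by (rule eq[OF _ lin_g lin_g]) (rule c_inj[OF *])
    then show "x = y" by (rule metric_eqI[OF g])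
  qed
  ultimately have "surj (\<lambda>x. ?c (g x))" by (rule fd.linear_inj_imp_surj)
  then obtain x where x: "?c f = ?c (g x)" by (rule surjE)
  have "f y = g x y" for y by (rule eq[OF _ f lin_g]) (rule c_inj[OF x])
  then show ?thesis by blast
qed

text \<open>For fixed \<open>y\<close> the functional \<open>x \<mapsto> g (f x) y\<close> is
  represented by a vector \<open>h y\<close>; by uniqueness this \<open>h\<close> is the
  adjoint.\<close>

lemma form_adjoint:
  assumes g: "metric g" and f: "Vector_Spaces.linear scale scale f"
  shows "g (f x) y = g x (form_adjoint g f y)"
proof -
  have "\<exists>z. \<forall>x. g (f x) y = g z x" for y
    by (rule linear_functional_representation[OF g])
      (use f g in \<open>simp add: Vector_Spaces.linear_iff metric_simps[OF g] metric_def\<close>)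
  then obtain h where h: "\<And>x y. g (f x) y = g (h y) x" by metis
  then have "\<And>x y. g (f x) y = g x (h y)" by (metis g metric_commute)
  with form_adjoint_eqI[OF g this] show ?thesis by simp
qed

text \<open>Because adjoints exist, pairing with an arbitrary \<open>y\<close> turns equations
  between maps into equations between values of \<open>g\<close>; nondegeneracy gives the way back.
  If \<open>g\<close> is not a metric, both sides are false.\<close>

lemma solitary_metric_iff:
  "solitary_metric g \<longleftrightarrow> ad_invariant_metric g \<and>
    (\<forall>\<phi>. ad_invariant_endo \<phi> \<and> (\<forall>x y. g (\<phi> x) y = g x (\<phi> y)) \<longrightarrow>
      (\<exists>D. derivation D \<and> (\<forall>x y. g (\<phi> x) y = g (D x) y + g x (D y))))"
proof (cases "metric g")
  case g: True
  have "form_adjoint g \<phi> = \<phi> \<longleftrightarrow> (\<forall>x y. g (\<phi> x) y = g x (\<phi> y))" if "ad_invariant_endo \<phi>" for \<phi>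
    using that form_adjoint[OF g, of \<phi>] form_adjoint_eqI[OF g, of \<phi> \<phi>]
    by (metis ad_invariant_endo_def)
  moreover have "(\<forall>x. \<phi> x = D x + form_adjoint g D x) \<longleftrightarrow>
      (\<forall>x y. g (\<phi> x) y = g (D x) y + g x (D y))" if "derivation D" for \<phi> D
  proof -
    have "g (form_adjoint g D x) y = g x (D y)" for x y
      using form_adjoint[OF g] that metric_commute[OF g] by (metis derivation_def)
    then have sum: "g (D x) y + g x (D y) = g (D x + form_adjoint g D x) y" for x y
      by (simp add: metric_simps[OF g])
    show ?thesis unfolding sum using metric_eqI[OF g] by metis
  qed
  ultimately show ?thesis unfolding solitary_metric_def by metis
qed (simp add: solitary_metric_def ad_invariant_metric_def)

text \<open>Representing the functional \<open>h x\<close> through \<open>g\<close> produces the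
  vector \<open>\<psi> x\<close>.\<close>

lemma ad_invariant_metrics_related:
  assumes "ad_invariant_metric g" and "ad_invariant_metric h"
  obtains \<psi> where "ad_invariant_endo \<psi>" and "\<And>x y. h x y = g (\<psi> x) y"
proof -
  have g: "metric g" and h: "metric h"
    using assms by (auto simp: ad_invariant_metric_def)
  have "\<exists>z. \<forall>y. h x y = g z y" for x
    by (rule linear_functional_representation[OF g]) (use h in \<open>simp add: metric_def\<close>)
  then obtain \<psi> where \<psi>: "\<And>x y. h x y = g (\<psi> x) y" by metis
  \<comment> \<open>Pair with \<open>z\<close>: the left side gives \<open>h (bracket x y) z = - h y
    (bracket x z) = - g (\<psi> y) (bracket x z)\<close>, which is
    \<open>g (bracket x (\<psi> y)) z\<close>.\<close>
  have "\<psi> (bracket x y) = bracket x (\<psi> y)" for x y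
    by (rule metric_eqI[OF g]) (metis \<psi> assms ad_invariant_metric_def)
  with linearI_metric[OF g h \<psi>] have "ad_invariant_endo \<psi>"
    by (simp add: ad_invariant_endo_def)
  then show thesis using \<psi> by (rule that)
qed

text \<open>A problem for \<open>g\<close> is moved to \<open>h\<close> by \<open>\<psi>\<close>,
  solved there, and the solution is moved back by \<open>\<theta>\<close>, the comparison map in the
  opposite direction.\<close>

lemma solitary_metric_independent:
  assumes "solitary_metric h" and "ad_invariant_metric g"
  shows "solitary_metric g"
  unfolding solitary_metric_iff
proof (intro conjI allI impI)
  fix \<phi>
  assume "ad_invariant_endo \<phi> \<and> (\<forall>x y. g (\<phi> x) y = g x (\<phi> y))"
  then have \<phi>: "ad_invariant_endo \<phi>" and sa: "\<And>x y. g (\<phi> x) y = g x (\<phi> y)" by auto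
  have h: "ad_invariant_metric h" using assms(1) by (simp add: solitary_metric_def)
  have comm: "g x y = g y x" "h x y = h y x" for x y
    using assms(2) h metric_commute by (auto simp: ad_invariant_metric_def)
  obtain \<psi> where \<psi>: "ad_invariant_endo \<psi>" "\<And>x y. g x y = h (\<psi> x) y"
    by (rule ad_invariant_metrics_related[OF h assms(2)]) blast
  obtain \<theta> where \<theta>: "ad_invariant_endo \<theta>" "\<And>x y. h x y = g (\<theta> x) y"
    by (rule ad_invariant_metrics_related[OF assms(2) h]) blast
  \<comment> \<open>By the choice of \<open>\<psi>\<close>, \<open>h (\<psi> (\<phi> x)) y\<close>
    is \<open>g (\<phi> x) y\<close>, so self-adjointness of \<open>\<phi>\<close> for
    \<open>g\<close> becomes self-adjointness of \<open>\<psi> \<circ> \<phi>\<close> for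
    \<open>h\<close>.\<close>
  have "\<forall>x y. h ((\<psi> \<circ> \<phi>) x) y = h x ((\<psi> \<circ> \<phi>) y)"
    using sa comm \<psi>(2) by (metis comp_apply)
  then obtain D where D: "derivation D" "\<And>x y. h ((\<psi> \<circ> \<phi>) x) y = h (D x) y + h x (D y)"
    using assms(1) ad_invariant_endo_comp[OF \<psi>(1) \<phi>] unfolding solitary_metric_iff by metis
  have "g (\<phi> x) y = g ((\<theta> \<circ> D) x) y + g x ((\<theta> \<circ> D) y)" for x y
  proof -
    have "g (\<phi> x) y = h (D x) y + h (D y) x"
      using D(2)[of x y] \<psi>(2) comm(2) by (metis comp_apply)
    also have "\<dots> = g (\<theta> (D x)) y + g x (\<theta> (D y))"
      using \<theta>(2) comm(1) by metis
    finally show ?thesis by simp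
  qed
  then show "\<exists>D. derivation D \<and> (\<forall>x y. g (\<phi> x) y = g (D x) y + g x (D y))"
    using derivation_comp[OF \<theta>(1) D(1)] by blast
qed (fact assms(2))

lemma solitary_iff_solitary_metric:
  assumes "ad_invariant_metric g"
  shows "solitary \<longleftrightarrow> solitary_metric g"
  using solitary_metric_independent[OF _ assms] by (auto simp: solitary_def)

end

section \<open>Complex-linear maps of the complexification\<close>

text \<open>This is \<open>a + \<i> b\<close>, with \<open>a\<close> and \<open>b\<close> extended
  complex-linearly from the real space.\<close>

definition complexify_map ::
  "('v \<Rightarrow> 'v) \<Rightarrow> ('v \<Rightarrow> 'v) \<Rightarrow> 'v \<times> 'v \<Rightarrow> 'v::ab_group_add \<times> 'v" where
  "complexify_map a b = (\<lambda>(x, y). (a x - b y, a y + b x))"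

lemma complexify_map_Pair [simp]: "complexify_map a b (x, y) = (a x - b y, a y + b x)"
  by (simp add: complexify_map_def)

lemma linear_complexify_map_iff:
  assumes "vector_space scale"
  shows "Vector_Spaces.linear (complexify_scale scale) (complexify_scale scale) (complexify_map a b)
    \<longleftrightarrow> Vector_Spaces.linear scale scale a \<and> Vector_Spaces.linear scale scale b"
    (is "?L \<longleftrightarrow> ?R")
proof
  interpret vector_space scale by fact
  assume ?L
  then interpret F: Vector_Spaces.linear "complexify_scale scale" "complexify_scale scale"
    "complexify_map a b" .
  \<comment> \<open>At \<open>(x, 0)\<close> the map has value
    \<open>(a x - b 0, a 0 + b x)\<close>, so \<open>a\<close> and \<open>b\<close> can be read off
    only once both are known to vanish at 0. Halving \<open>b 0 + b 0 = 0\<close> goes through the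
    real scalar 2.\<close>
  have "a 0 = b 0" and "b 0 + b 0 = 0"
    using F.scale[of 0 "(0, 0)"] by auto
  moreover from this(2) have "scale 2 (b 0) = 0"
    using scale_left_distrib[of 1 1 "b 0"] by simp
  ultimately have zero: "a 0 = 0" "b 0 = 0" by auto
  have "a (x + y) = a x + a y \<and> b (x + y) = b x + b y" for x y
    using F.add[of "(x, 0)" "(y, 0)"] by (simp add: zero)
  moreover have "a (scale c x) = scale c (a x) \<and> b (scale c x) = scale c (b x)" for c x
    using F.scale[of "complex_of_real c" "(x, 0)"] by (simp add: zero)
  ultimately show ?R by (simp add: Vector_Spaces.linear_iff vector_space_axioms)
next
  interpret vector_space scale by fact
  assume ?R
  then interpret a: Vector_Spaces.linear scale scale a + b: Vector_Spaces.linear scale scale b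
    by simp_all
  show ?L
    unfolding Vector_Spaces.linear_iff
    by (auto simp: vector_space_complexify[OF assms] a.add a.diff a.scale b.add b.diff b.scale
      scale_right_distrib scale_right_diff_distrib)
qed

text \<open>Since \<open>(x, y)\<close> is \<open>(x, 0)\<close> plus \<open>\<i>\<close> times
  \<open>(y, 0)\<close>, \<open>F\<close> is determined by its values on real vectors;
  \<open>a\<close> and \<open>b\<close> are the real and imaginary parts of these values.\<close>

lemma linear_complexify_cases:
  assumes "vector_space scale"
    and "Vector_Spaces.linear (complexify_scale scale) (complexify_scale scale) F"
  obtains a b where "F = complexify_map a b"
proof
  interpret vector_space scale by fact
  interpret F: Vector_Spaces.linear "complexify_scale scale" "complexify_scale scale" F by fact
  show "F = complexify_map (\<lambda>x. fst (F (x, 0))) (\<lambda>x. snd (F (x, 0)))"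
  proof
    fix p :: "'a \<times> 'a"
    obtain x y where p: "p = (x, y)" by force
    have "F p = F ((x, 0) + complexify_scale scale \<i> (y, 0))" by (simp add: p)
    also have "\<dots> = F (x, 0) + complexify_scale scale \<i> (F (y, 0))"
      by (simp only: F.add F.scale)
    also have "\<dots> = complexify_map (\<lambda>x. fst (F (x, 0))) (\<lambda>x. snd (F (x, 0))) p"
      by (cases "F (x, 0)"; cases "F (y, 0)") (simp add: p add.commute)
    finally show "F p = \<dots>" .
  qed
qed

text \<open>A finite spanning set of the real space, embedded by \<open>x \<mapsto> (x, 0)\<close>,
  also spans over the complex numbers.\<close>

lemma finite_dimensional_lie_algebra_complexify:
  assumes "finite_dimensional_lie_algebra scale bracket"
  shows "finite_dimensional_lie_algebra (complexify_scale scale) (complexify_bracket bracket)"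
proof -
  interpret finite_dimensional_lie_algebra scale bracket by fact
  interpret C: lie_algebra "complexify_scale scale" "complexify_bracket bracket"
    by (rule lie_algebra_complexify) unfold_locales
  obtain B where B: "finite B" "span B = UNIV" using finite_dimensional by blast
  let ?S = "C.span ((\<lambda>x. (x, 0)) ` B)"
  have "(x, 0) \<in> ?S" if "x \<in> span B" for x
    using that
  proof (induction rule: span_induct_alt)
    case (step c x y)
    then have "complexify_scale scale (complex_of_real c) (x, 0) + (y, 0) \<in> ?S"
      by (intro C.span_add C.span_scale) (auto intro: C.span_base)
    then show ?case by simp
  qed (use C.span_zero in \<open>simp add: zero_prod_def\<close>)
  then have "(x, 0) + complexify_scale scale \<i> (y, 0) \<in> ?S" for x y
    by (intro C.span_add C.span_scale) (simp_all add: B(2))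
  then have "?S = UNIV" by auto
  with B(1) show ?thesis by unfold_locales blast
qed

section \<open>Splitting conditions on the complexification into real and imaginary parts\<close>

context
  fixes scale :: "real \<Rightarrow> 'v::ab_group_add \<Rightarrow> 'v" and bracket :: "'v \<Rightarrow> 'v \<Rightarrow> 'v"
  assumes lie_algebra: "lie_algebra scale bracket"
begin

interpretation lie_algebra scale bracket by (fact lie_algebra)

interpretation C: lie_algebra "complexify_scale scale" "complexify_bracket bracket"
  by (rule lie_algebra_complexify) (fact lie_algebra)

text \<open>On real vectors \<open>(x, 0)\<close> and \<open>(y, 0)\<close> the two components of
  the condition are the conditions on \<open>a\<close> and on \<open>b\<close>; bilinearity extends
  them back to all pairs.\<close>

lemma ad_invariant_endo_complexify_map_iff:
  "C.ad_invariant_endo (complexify_map a b) \<longleftrightarrow> ad_invariant_endo a \<and> ad_invariant_endo b"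
    (is "?L \<longleftrightarrow> ?R")
proof
  assume L: ?L
  then have lin: "Vector_Spaces.linear scale scale a" "Vector_Spaces.linear scale scale b"
    by (auto simp: C.ad_invariant_endo_def linear_complexify_map_iff[OF vector_space_axioms])
  interpret a: Vector_Spaces.linear scale scale a by fact
  interpret b: Vector_Spaces.linear scale scale b by fact
  have "complexify_map a b (complexify_bracket bracket (x, 0) (y, 0)) =
      complexify_bracket bracket (x, 0) (complexify_map a b (y, 0))" for x y
    using L by (simp only: C.ad_invariant_endo_def)
  then show ?R by (simp add: ad_invariant_endo_def lin a.zero b.zero bracket_simps)
next
  assume R: ?R
  then interpret a: Vector_Spaces.linear scale scale a + b: Vector_Spaces.linear scale scale b
    by (simp_all add: ad_invariant_endo_def)
  show ?L
    using R
    by (auto simp: C.ad_invariant_endo_def linear_complexify_map_iff[OF vector_space_axioms]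
      ad_invariant_endo_def a.add a.diff b.add b.diff bracket_simps)
qed

text \<open>The Leibniz rule, tested on real vectors, separates in the same way.\<close>

lemma derivation_complexify_map_iff:
  "C.derivation (complexify_map a b) \<longleftrightarrow> derivation a \<and> derivation b" (is "?L \<longleftrightarrow> ?R")
proof
  assume L: ?L
  then have lin: "Vector_Spaces.linear scale scale a" "Vector_Spaces.linear scale scale b"
    by (auto simp: C.derivation_def linear_complexify_map_iff[OF vector_space_axioms])
  interpret a: Vector_Spaces.linear scale scale a by fact
  interpret b: Vector_Spaces.linear scale scale b by fact
  have "complexify_map a b (complexify_bracket bracket (x, 0) (y, 0)) =
      complexify_bracket bracket (complexify_map a b (x, 0)) (y, 0) +
      complexify_bracket bracket (x, 0) (complexify_map a b (y, 0))" for x y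
    using L by (simp only: C.derivation_def)
  then show ?R by (simp add: derivation_def lin a.zero b.zero bracket_simps)
next
  assume R: ?R
  then interpret a: Vector_Spaces.linear scale scale a + b: Vector_Spaces.linear scale scale b
    by (simp_all add: derivation_def)
  show ?L
    using R
    by (auto simp: C.derivation_def linear_complexify_map_iff[OF vector_space_axioms]
      derivation_def a.add a.diff b.add b.diff bracket_simps)
qed

context
  fixes g :: "'v \<Rightarrow> 'v \<Rightarrow> real"
  assumes g: "metric g"
begin

lemma metric_complexify: "C.metric (complexify_form g)"
proof -
  have "vector_space ((*) :: complex \<Rightarrow> complex \<Rightarrow> complex)"
    by unfold_locales (simp_all add: algebra_simps)
  moreover have "p = 0" if p: "\<forall>q. complexify_form g p q = 0" for p
  proof -
    obtain x y where xy: "p = (x, y)" by force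
    \<comment> \<open>Pairing with a real vector \<open>(u, 0)\<close> gives \<open>g x u\<close> as
      real part and \<open>g y u\<close> as imaginary part, so nondegeneracy of \<open>g\<close>
      applies to each.\<close>
    have "g x u = 0 \<and> g y u = 0" for u
      using p[rule_format, of "(u, 0)"] by (simp add: xy metric_simps[OF g] complex_eq_iff)
    then show ?thesis using g by (auto simp: xy metric_def zero_prod_def)
  qed
  ultimately show ?thesis
    unfolding C.metric_def Vector_Spaces.linear_iff
    by (auto simp: C.vector_space_axioms metric_simps[OF g] complex_eq_iff metric_commute[OF g]
      algebra_simps)
qed

lemma complexify_form_self_adjoint_iff:
  "(\<forall>p q. complexify_form g (complexify_map a b p) q = complexify_form g p (complexify_map a b q))
    \<longleftrightarrow> (\<forall>x y. g (a x) y = g x (a y)) \<and> (\<forall>x y. g (b x) y = g x (b y))"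
  if "a 0 = 0" "b 0 = 0"
proof (intro iffI conjI allI)
  fix x y
  assume "\<forall>p q. complexify_form g (complexify_map a b p) q =
    complexify_form g p (complexify_map a b q)"
  from this[rule_format, of "(x, 0)" "(y, 0)"]
  show "g (a x) y = g x (a y)" "g (b x) y = g x (b y)"
    by (simp_all add: that metric_simps[OF g])
next
  fix p q :: "'v \<times> 'v"
  assume "(\<forall>x y. g (a x) y = g x (a y)) \<and> (\<forall>x y. g (b x) y = g x (b y))"
  then show "complexify_form g (complexify_map a b p) q = complexify_form g p (complexify_map a b q)"
    by (cases p; cases q) (simp add: metric_simps[OF g])
qed

text \<open>With \<open>a + \<i> b\<close> as endomorphism and \<open>c + \<i> d\<close> as
  derivation, the polarised equation on real vectors has \<open>a\<close>, \<open>c\<close> in its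
  real part and \<open>b\<close>, \<open>d\<close> in its imaginary part. Vanishing at 0 makes the
  values at \<open>(x, 0)\<close> clean.\<close>

lemma complexify_form_derivative_iff:
  "(\<forall>p q. complexify_form g (complexify_map a b p) q =
      complexify_form g (complexify_map c d p) q + complexify_form g p (complexify_map c d q))
    \<longleftrightarrow> (\<forall>x y. g (a x) y = g (c x) y + g x (c y)) \<and> (\<forall>x y. g (b x) y = g (d x) y + g x (d y))"
  if "a 0 = 0" "b 0 = 0" "c 0 = 0" "d 0 = 0"
proof (intro iffI conjI allI)
  fix x y
  assume "\<forall>p q. complexify_form g (complexify_map a b p) q =
    complexify_form g (complexify_map c d p) q + complexify_form g p (complexify_map c d q)"
  from this[rule_format, of "(x, 0)" "(y, 0)"]
  show "g (a x) y = g (c x) y + g x (c y)" "g (b x) y = g (d x) y + g x (d y)"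
    by (simp_all add: that metric_simps[OF g] complex_eq_iff)
next
  fix p q :: "'v \<times> 'v"
  assume "(\<forall>x y. g (a x) y = g (c x) y + g x (c y)) \<and> (\<forall>x y. g (b x) y = g (d x) y + g x (d y))"
  then show "complexify_form g (complexify_map a b p) q =
    complexify_form g (complexify_map c d p) q + complexify_form g p (complexify_map c d q)"
    by (cases p; cases q) (simp add: metric_simps[OF g] complex_eq_iff)
qed

end

lemma ad_invariant_metric_complexify:
  assumes "ad_invariant_metric g"
  shows "C.ad_invariant_metric (complexify_form g)"
proof -
  have g: "metric g" and inv: "g (bracket x y) z = - g y (bracket x z)" for x y z
    using assms by (auto simp: ad_invariant_metric_def)
  show ?thesis
    unfolding C.ad_invariant_metric_def
    by (auto simp: metric_complexify[OF g] metric_simps[OF g] complex_eq_iff inv)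
qed

end

section \<open>Passing between solitary metrics on the real algebra and on its
  complexification\<close>

theorem proposition3p2:
  fixes scale :: "real \<Rightarrow> 'v::ab_group_add \<Rightarrow> 'v"
    and bracket :: "'v \<Rightarrow> 'v \<Rightarrow> 'v"
    and g :: "'v \<Rightarrow> 'v \<Rightarrow> real"
  assumes "finite_dimensional_lie_algebra scale bracket"
    and "lie_algebra.ad_invariant_metric scale bracket g"
  shows "lie_algebra.solitary scale bracket \<longleftrightarrow>
    lie_algebra.solitary_metric (complexify_scale scale) (complexify_bracket bracket)
      (complexify_form g)"
proof -
  interpret finite_dimensional_lie_algebra scale bracket by fact
  interpret C: finite_dimensional_lie_algebra "complexify_scale scale" "complexify_bracket bracket"
    by (rule finite_dimensional_lie_algebra_complexify) fact
  note lie = lie_algebra_axioms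
  have g: "metric g" using assms(2) by (simp add: ad_invariant_metric_def)
  have lin0: "a 0 = 0" if "Vector_Spaces.linear scale scale a" for a
    using that unfolding Vector_Spaces.linear_iff
    by (metis add.right_neutral add_cancel_right_right)
  have endo0: "a 0 = 0" if "ad_invariant_endo a" for a
    using that lin0 by (auto simp: ad_invariant_endo_def)
  have der0: "a 0 = 0" if "derivation a" for a
    using that lin0 by (auto simp: derivation_def)
  have "solitary_metric g \<longleftrightarrow> C.solitary_metric (complexify_form g)"
  proof
    assume sol: "solitary_metric g"
    show "C.solitary_metric (complexify_form g)"
      unfolding C.solitary_metric_iff
    proof (intro conjI allI impI; (elim conjE)?)
      fix \<phi>
      assume \<phi>: "C.ad_invariant_endo \<phi>"
        and sa: "\<forall>p q. complexify_form g (\<phi> p) q = complexify_form g p (\<phi> q)"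
      obtain a b where ab: "\<phi> = complexify_map a b"
        using \<phi> linear_complexify_cases[OF vector_space_axioms]
        by (auto simp: C.ad_invariant_endo_def)
      have endo: "ad_invariant_endo a" "ad_invariant_endo b"
        using \<phi> by (auto simp: ab ad_invariant_endo_complexify_map_iff[OF lie])
      note zero = endo[THEN endo0]
      have sa_ab: "\<forall>x y. g (a x) y = g x (a y)" "\<forall>x y. g (b x) y = g x (b y)"
        using sa unfolding ab complexify_form_self_adjoint_iff[where a = a and b = b, OF lie g zero]
        by auto
      \<comment> \<open>The parts \<open>a\<close> and \<open>b\<close> are each self-adjoint for
        \<open>g\<close>, so each is solved separately over the reals; \<open>c + \<i> d\<close>
        then solves the complex problem.\<close>
      obtain c where c: "derivation c" "\<forall>x y. g (a x) y = g (c x) y + g x (c y)"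
        using sol endo(1) sa_ab(1) unfolding solitary_metric_iff by blast
      obtain d where d: "derivation d" "\<forall>x y. g (b x) y = g (d x) y + g x (d y)"
        using sol endo(2) sa_ab(2) unfolding solitary_metric_iff by blast
      show "\<exists>D. C.derivation D \<and> (\<forall>p q. complexify_form g (\<phi> p) q =
          complexify_form g (D p) q + complexify_form g p (D q))"
      proof (intro exI conjI)
        show "C.derivation (complexify_map c d)"
          using c(1) d(1) by (simp add: derivation_complexify_map_iff[OF lie])
        show "\<forall>p q. complexify_form g (\<phi> p) q = complexify_form g (complexify_map c d p) q +
            complexify_form g p (complexify_map c d q)"
          unfolding ab complexify_form_derivative_iff[where a = a and b = b and c = c and d = d,
            OF lie g zero der0[OF c(1)] der0[OF d(1)]]
          using c(2) d(2) by blast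
      qed
    qed (rule ad_invariant_metric_complexify[OF lie assms(2)])
  next
    assume sol: "C.solitary_metric (complexify_form g)"
    show "solitary_metric g"
      unfolding solitary_metric_iff
    proof (intro conjI allI impI; (elim conjE)?)
      fix \<phi>
      assume \<phi>: "ad_invariant_endo \<phi>" and sa: "\<forall>x y. g (\<phi> x) y = g x (\<phi> y)"
      \<comment> \<open>The complex-linear extension of \<open>\<phi>\<close>, with zero imaginary
        part.\<close>
      let ?\<phi> = "complexify_map \<phi> (\<lambda>_. 0)"
      have "ad_invariant_endo (\<lambda>_. 0)"
        by (simp add: ad_invariant_endo_def Vector_Spaces.linear_iff vector_space_axioms bracket_simps)
      with \<phi> have "C.ad_invariant_endo ?\<phi>"
        by (simp add: ad_invariant_endo_complexify_map_iff[OF lie])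
      moreover have "\<forall>p q. complexify_form g (?\<phi> p) q = complexify_form g p (?\<phi> q)"
        unfolding complexify_form_self_adjoint_iff[where a = \<phi> and b = "\<lambda>_. 0",
          OF lie g endo0[OF \<phi>] refl]
        using sa by (simp add: metric_simps[OF g])
      ultimately obtain D where D: "C.derivation D" "\<forall>p q. complexify_form g (?\<phi> p) q =
          complexify_form g (D p) q + complexify_form g p (D q)"
        using sol unfolding C.solitary_metric_iff by blast
      obtain c d where cd: "D = complexify_map c d"
        using D(1) linear_complexify_cases[OF vector_space_axioms]
        by (auto simp: C.derivation_def)
      have der: "derivation c" "derivation d"
        using D(1) by (auto simp: cd derivation_complexify_map_iff[OF lie])
      \<comment> \<open>The real part of the complex equation: the real part \<open>c\<close> of
        \<open>D\<close> is already the required derivation.\<close>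
      have "\<forall>x y. g (\<phi> x) y = g (c x) y + g x (c y)"
        using D(2)
        unfolding cd complexify_form_derivative_iff[where a = \<phi> and b = "\<lambda>_. 0" and c = c and d = d,
          OF lie g endo0[OF \<phi>] refl der[THEN der0]]
        by blast
      with der(1) show "\<exists>D. derivation D \<and> (\<forall>x y. g (\<phi> x) y = g (D x) y + g x (D y))"
        by blast
    qed (fact assms(2))
  qed
  \<comment> \<open>Independence of the metric replaces the existential \<open>solitary\<close> by
    the statement about the given \<open>g\<close>.\<close>
  with solitary_iff_solitary_metric[OF assms(2)] show ?thesis by simp
qed

end
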